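(* The lifted uncertainty set $$\mathcal U'=\big\{(\boldsymbol w,\boldsymbol u)\in\mathbb R^L\times\mathcal U:\ w_\ell=\max\{0,\boldsymbol f_\ell^\top\boldsymbol u\}\ \ \forall\ell\in[L]\big\}$$ can be represented as the set $$\mathcal U'=\left\{(\boldsymbol w,\boldsymbol u)\in\mathbb R^L\times\mathcal U:\ \begin{array}{l}\boldsymbol 0\le\boldsymbol w\le\overline{\boldsymbol w}\\ w_\ell\ge\boldsymbol f_\ell^\top\boldsymbol u\quad\forall\ell\in[L]\\ w_\ell(w_\ell-\boldsymbol f_\ell^\top\boldsymbol u)=0\quad\forall\ell\in[L]\end{array}\right\},$$ where $\overline{\boldsymbol w}\in\mathbb R^L$ is a vector whose components are upper bounds on the auxiliary parameters $w_1,\dots,w_L$. These upper bounds can be computed by solving the $L$ convex conic optimization problems $$\overline w_\ell:=\max_{\boldsymbol u\in\mathcal U^0}\ \boldsymbol f_\ell^\top\boldsymbol u\qquad\forall\ell\in[L].$$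
   Context: $[L]=\{1,\dots,L\}$; $\mathbf e_{K+1}$ is the last standard basis vector of $\mathbb R^{K+1}$. $\mathcal K\subseteq\mathbb R^K\times\mathbb R_+$ is a closed convex cone, $\widehat{\boldsymbol C}_i$ ($i\in[I]$) are symmetric $(K+1)\times(K+1)$ matrices, $$\mathcal U=\{\boldsymbol u\in\mathcal K:\mathbf e_{K+1}^\top\boldsymbol u=1,\ \boldsymbol u^\top\widehat{\boldsymbol C}_i\boldsymbol u=0\ \forall i\in[I]\},\qquad \mathcal U^0=\{\boldsymbol u\in\mathcal K:\mathbf e_{K+1}^\top\boldsymbol u=1\}.$$ Standing assumptions: $\mathcal U^0$ is nonempty and compact, and $\min_{\boldsymbol u\in\mathcal U^0}\boldsymbol u^\top\widehat{\boldsymbol C}_i\boldsymbol u=0$ for every $i\in[I]$. The vectors $\boldsymbol f_\ell=(\boldsymbol g_\ell,-h_\ell)\in\mathbb R^{K+1}$, $\ell\in[L]$, are given, where $\boldsymbol g_\ell\in\mathbb R^K$ is the folding direction and $h_\ell\in\mathbb R$ the breakpoint of the $\ell$-th piecewise linear mapping $F_\ell(\boldsymbol u)=\max\{0,\boldsymbol f_\ell^\top\boldsymbol u\}$.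
   Formalization: The maxima over U^0 are used as the upper bounds only when all are nonnegative; in general the bound is max{0, max over U^0 of f_l^T u}, since a negative maximum makes 0 ≤ w ≤ w-bar infeasible while U' can be nonempty. *)

theory Defs
  imports "HOL-Analysis.Analysis"
begin

text \<open>
  Vectors of dimension \<open>K + 1\<close> are rendered as \<open>real ^ ('k option)\<close> with \<open>K = CARD('k)\<close>: the
  coordinates \<open>Some j\<close> are the first \<open>K\<close> ones and \<open>None\<close> is the last one, so that
  \<open>axis None 1\<close> is the last standard basis vector.
\<close>

definition has_minimum_on :: "('a \<Rightarrow> real) \<Rightarrow> 'a set \<Rightarrow> real \<Rightarrow> bool" where
  "has_minimum_on \<phi> S m \<longleftrightarrow> (\<exists>x\<in>S. \<phi> x = m) \<and> (\<forall>x\<in>S. m \<le> \<phi> x)"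

definition has_maximum_on :: "('a \<Rightarrow> real) \<Rightarrow> 'a set \<Rightarrow> real \<Rightarrow> bool" where
  "has_maximum_on \<phi> S m \<longleftrightarrow> (\<exists>x\<in>S. \<phi> x = m) \<and> (\<forall>x\<in>S. \<phi> x \<le> m)"

definition base_set :: "(real ^ ('k::finite option)) set \<Rightarrow> (real ^ ('k option)) set" where
  "base_set \<K> = {u \<in> \<K>. axis None 1 \<bullet> u = 1}"

definition uncertainty_set ::
  "(real ^ ('k::finite option)) set \<Rightarrow> nat \<Rightarrow> (nat \<Rightarrow> real ^ ('k option) ^ ('k option))
    \<Rightarrow> (real ^ ('k option)) set" where
  "uncertainty_set \<K> I C =
    {u \<in> \<K>. axis None 1 \<bullet> u = 1 \<and> (\<forall>i\<in>{1..I}. u \<bullet> (C i *v u) = 0)}"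

definition fold_vec :: "real ^ 'k \<Rightarrow> real \<Rightarrow> real ^ ('k::finite option)" where
  "fold_vec g h = (\<chi> j. case j of Some k \<Rightarrow> g $ k | None \<Rightarrow> - h)"

definition fold_map :: "real ^ ('k::finite option) \<Rightarrow> real ^ ('k option) \<Rightarrow> real" where
  "fold_map f u = max 0 (f \<bullet> u)"

definition lifted_set ::
  "('l::finite \<Rightarrow> real ^ ('k::finite option)) \<Rightarrow> (real ^ ('k option)) set
    \<Rightarrow> ((real ^ 'l) \<times> (real ^ ('k option))) set" where
  "lifted_set f \<U> = {(w, u). u \<in> \<U> \<and> (\<forall>l. w $ l = fold_map (f l) u)}"

text \<open>The order on \<open>real ^ 'l\<close> used below is the componentwise one.\<close>

definition complementarity_set ::
  "('l::finite \<Rightarrow> real ^ ('k::finite option)) \<Rightarrow> (real ^ ('k option)) set \<Rightarrow> real ^ 'l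
    \<Rightarrow> ((real ^ 'l) \<times> (real ^ ('k option))) set" where
  "complementarity_set f \<U> wbar =
    {(w, u). u \<in> \<U> \<and> 0 \<le> w \<and> w \<le> wbar \<and>
       (\<forall>l. w $ l \<ge> f l \<bullet> u) \<and> (\<forall>l. w $ l * (w $ l - f l \<bullet> u) = 0)}"

definition upper_bounds_on_lift ::
  "('l::finite \<Rightarrow> real ^ ('k::finite option)) \<Rightarrow> (real ^ ('k option)) set \<Rightarrow> real ^ 'l \<Rightarrow> bool" where
  "upper_bounds_on_lift f \<U> wbar \<longleftrightarrow> (\<forall>(w, u) \<in> lifted_set f \<U>. w \<le> wbar)"

text \<open>
  If some \<open>f l \<bullet> u\<close> is negative on the whole base set, then the maximum \<open>m\<close> of \<open>f l \<bullet> u\<close> is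
  negative and \<open>0 \<le> w $ l \<le> m\<close> has no solution although \<open>w $ l = 0\<close> in the lifted set. The
  maxima are therefore used as they stand only when they are nonnegative (the breakpoint is
  not beyond the range of the folding direction), and otherwise are replaced by
  their positive parts.
\<close>

end

theory Submission
  imports Defs
begin

text \<open>Fix \<open>u\<close> and argue coordinatewise. The product condition forces
  \<open>w $ l\<close> to be 0 or \<open>f l \<bullet> u\<close>, and the two lower bounds select
  the larger, so these conditions alone describe \<open>max 0 (f l \<bullet> u)\<close>
  (\<open>eq_max_0_iff_complementarity\<close>). The box constraint \<open>w \<le> wbar\<close> then
  cuts nothing off, provided \<open>wbar\<close> bounds every lift
  (\<open>lifted_set_eq_complementarity_set\<close>). Such bounds come from maximizing
  \<open>f l \<bullet> u\<close> over the compact base set, a relaxation of the uncertainty set. A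
  negative maximum would exclude the value \<open>w $ l = 0\<close>, hence the sign condition or the
  passage to positive parts.\<close>

lemma eq_max_0_iff_complementarity:
  fixes w a :: real
  shows "w = max 0 a \<longleftrightarrow> 0 \<le> w \<and> a \<le> w \<and> w * (w - a) = 0"
  by (auto simp: max_def)

lemma lifted_set_eq_complementarity_set:
  assumes "upper_bounds_on_lift f \<U> wbar"
  shows "lifted_set f \<U> = complementarity_set f \<U> wbar"
proof -
  have "(w, u) \<in> lifted_set f \<U> \<longleftrightarrow> (w, u) \<in> complementarity_set f \<U> wbar" for w u
  proof -
    have "(\<forall>l. w $ l = fold_map (f l) u)
      \<longleftrightarrow> 0 \<le> w \<and> (\<forall>l. w $ l \<ge> f l \<bullet> u) \<and> (\<forall>l. w $ l * (w $ l - f l \<bullet> u) = 0)"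
      unfolding fold_map_def eq_max_0_iff_complementarity less_eq_vec_def by auto
    \<comment> \<open>The bound on lifts serves the inclusion of the lifted set in the
      complementarity set; the converse inclusion just drops \<open>w \<le> wbar\<close>.\<close>
    moreover have "w \<le> wbar" if "(w, u) \<in> lifted_set f \<U>"
      using assms that unfolding upper_bounds_on_lift_def by blast
    ultimately show ?thesis
      unfolding lifted_set_def complementarity_set_def by blast
  qed
  then show ?thesis by auto
qed

text \<open>A lift takes one of two values in each coordinate: \<open>0 \<le> wbar\<close> covers
  the value 0, the second assumption the value \<open>f l \<bullet> u\<close>.\<close>

lemma upper_bounds_on_lift_if_dominates:
  assumes "0 \<le> wbar" and "\<And>l u. u \<in> \<U> \<Longrightarrow> f l \<bullet> u \<le> wbar $ l"
  shows "upper_bounds_on_lift f \<U> wbar"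
  using assms
  by (auto simp: upper_bounds_on_lift_def lifted_set_def fold_map_def less_eq_vec_def)

lemma uncertainty_set_subset_base_set: "uncertainty_set \<K> I C \<subseteq> base_set \<K>"
  by (auto simp: uncertainty_set_def base_set_def)

lemma compact_has_maximum_on_inner:
  fixes S :: "('a::real_inner) set"
  assumes "compact S" and "S \<noteq> {}"
  shows "\<exists>m. has_maximum_on (\<lambda>u. a \<bullet> u) S m"
  using continuous_attains_sup[OF assms, of "\<lambda>u. a \<bullet> u"]
  by (force simp: has_maximum_on_def intro: continuous_intros)

theorem theorem3:
  fixes \<K> :: "(real ^ ('k::finite option)) set"
    and I :: nat
    and C :: "nat \<Rightarrow> real ^ ('k option) ^ ('k option)"
    and g :: "'l::finite \<Rightarrow> real ^ 'k"
    and h :: "'l \<Rightarrow> real"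
    and f :: "'l \<Rightarrow> real ^ ('k option)"
  assumes "closed \<K>" and "convex \<K>" and "cone \<K>"
    and "\<forall>u\<in>\<K>. u $ None \<ge> 0"
    and "\<forall>i\<in>{1..I}. transpose (C i) = C i"
    and "base_set \<K> \<noteq> {}" and "compact (base_set \<K>)"
    and "\<forall>i\<in>{1..I}. has_minimum_on (\<lambda>u. u \<bullet> (C i *v u)) (base_set \<K>) 0"
    and "\<forall>l. f l = fold_vec (g l) (h l)"
  shows "(\<forall>wbar. upper_bounds_on_lift f (uncertainty_set \<K> I C) wbar \<longrightarrow>
            lifted_set f (uncertainty_set \<K> I C)
              = complementarity_set f (uncertainty_set \<K> I C) wbar)
       \<and> (\<exists>m :: real ^ 'l.
            (\<forall>l. has_maximum_on (\<lambda>u. f l \<bullet> u) (base_set \<K>) (m $ l))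
          \<and> (0 \<le> m \<longrightarrow>
               upper_bounds_on_lift f (uncertainty_set \<K> I C) m
             \<and> lifted_set f (uncertainty_set \<K> I C)
                 = complementarity_set f (uncertainty_set \<K> I C) m)
          \<and> upper_bounds_on_lift f (uncertainty_set \<K> I C) (\<chi> l. max 0 (m $ l))
          \<and> lifted_set f (uncertainty_set \<K> I C)
              = complementarity_set f (uncertainty_set \<K> I C) (\<chi> l. max 0 (m $ l)))"
proof -
  let ?U = "uncertainty_set \<K> I C"
  have "\<forall>l. \<exists>m. has_maximum_on (\<lambda>u. f l \<bullet> u) (base_set \<K>) m"
    using compact_has_maximum_on_inner[OF \<open>compact (base_set \<K>)\<close> \<open>base_set \<K> \<noteq> {}\<close>] by blast
  then obtain m0 where m0: "\<And>l. has_maximum_on (\<lambda>u. f l \<bullet> u) (base_set \<K>) (m0 l)"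
    by metis
  define m :: "real ^ 'l" where "m = (\<chi> l. m0 l)"
  have max: "has_maximum_on (\<lambda>u. f l \<bullet> u) (base_set \<K>) (m $ l)" for l
    using m0 by (simp add: m_def)
  \<comment> \<open>Dropping the quadratic equations only enlarges the feasible set, so the maxima
    over \<open>base_set \<K>\<close> remain valid bounds on \<open>?U\<close>.\<close>
  have le: "f l \<bullet> u \<le> m $ l" if "u \<in> ?U" for l u
    using max[of l] that uncertainty_set_subset_base_set unfolding has_maximum_on_def by blast
  have "0 \<le> m \<Longrightarrow> upper_bounds_on_lift f ?U m"
    by (rule upper_bounds_on_lift_if_dominates) (use le in auto)
  \<comment> \<open>Positive parts are nonnegative and still dominate
    \<open>f l \<bullet> u\<close>, whatever the signs of the maxima.\<close>
  moreover have "upper_bounds_on_lift f ?U (\<chi> l. max 0 (m $ l))"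
    using le by (intro upper_bounds_on_lift_if_dominates) (auto simp: less_eq_vec_def le_max_iff_disj)
  ultimately show ?thesis
    using max lifted_set_eq_complementarity_set by blast
qed

end
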